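(* Let $m\ge 1$ be an integer. For any constant $C\in\mathbb{R}$, let $N=\{(x_1,\ldots, x_m,z)\in \mathbb{R}^{m+1} : z>-C\}$ and let $f$ be a smooth nowhere-vanishing function of $z\in(-C,\infty)$. Then the conformally flat space $$\Big(N,\ h=f^{-2}(z)\Big(\sum_{i=1}^m dx_i^{2}+dz^{2}\Big)\Big)$$ is foliated by proper biharmonic hyperplanes $z=k$ ($k\in \mathbb{R}$, $k>-C$), i.e. every hyperplane $z=k$ with $k>-C$ is a proper biharmonic hypersurface of $(N,h)$, if and only if $f(z)=\frac{D}{z+E}$ for some constants $E\geq C$ and $D\in \mathbb{R}\setminus\{0\}$.
   Context: All manifolds, maps and tensor fields are smooth. A map $\varphi:(M,g)\to(N,h)$ between Riemannian manifolds has tension field $\tau(\varphi)=\mathrm{Trace}_g\nabla d\varphi$. It is biharmonic if it is a critical point of the bienergy $E^2(\varphi,\Omega)=\frac12\int_\Omega|\tau(\varphi)|^2dx$ for every compact $\Omega\subset M$; equivalently, its bitension field $$\tau^2(\varphi)=\mathrm{Trace}_g(\nabla^\varphi\nabla^\varphi-\nabla^\varphi_{\nabla^M})\tau(\varphi)-\mathrm{Trace}_g R^N(d\varphi,\tau(\varphi))d\varphi$$ vanishes identically, where $R^N(X,Y)Z=[\nabla^N_X,\nabla^N_Y]Z-\nabla^N_{[X,Y]}Z$. A submanifold is called biharmonic if its inclusion map, taken with the induced metric, is a biharmonic isometric immersion. It is proper biharmonic if it is biharmonic and not minimal. *)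

theory Defs
  imports "HOL-Analysis.Analysis"
begin

section \<open>Riemannian metrics on open subsets of a Euclidean space\<close>

text \<open>
  Manifolds are open subsets of Euclidean spaces, each with its single global chart, so every
  tangent space is the ambient vector space. A metric assigns to a point \<open>p\<close> an inner product
  \<open>g p\<close>. All notions below are local: at a point of an open set \<open>N\<close> they depend only on
  the values of the metric and of the fields near that point, whatever they are outside \<open>N\<close>.
\<close>

type_synonym 'a metric = "'a \<Rightarrow> 'a \<Rightarrow> 'a \<Rightarrow> real"

definition sharp :: "'a::euclidean_space metric \<Rightarrow> 'a \<Rightarrow> ('a \<Rightarrow> real) \<Rightarrow> 'a" where
  "sharp g p \<alpha> = (THE w. \<forall>v. g p w v = \<alpha> v)"

text \<open>Since \<open>sharp g p (\<lambda>v. e\<^sub>i \<bullet> v)\<close> is \<open>\<Sum>\<^sub>j g\<^sup>i\<^sup>j e\<^sub>j\<close>, the following is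
  \<open>\<Sum>\<^sub>i\<^sub>,\<^sub>j g\<^sup>i\<^sup>j B(e\<^sub>i, e\<^sub>j)\<close>.\<close>

definition metric_trace ::
  "'a::euclidean_space metric \<Rightarrow> 'a \<Rightarrow> ('a \<Rightarrow> 'a \<Rightarrow> 'b::real_vector) \<Rightarrow> 'b" where
  "metric_trace g p B = (\<Sum>e\<in>Basis. B e (sharp g p (\<lambda>v. e \<bullet> v)))"

text \<open>The Christoffel symbols of the Levi-Civita connection, as a vector-valued bilinear form
  (Koszul's formula for constant vector fields, whose brackets vanish).\<close>

definition christoffel :: "'a::euclidean_space metric \<Rightarrow> 'a \<Rightarrow> 'a \<Rightarrow> 'a \<Rightarrow> 'a" where
  "christoffel g p u v = sharp g p (\<lambda>w.
     (frechet_derivative (\<lambda>q. g q v w) (at p) u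
      + frechet_derivative (\<lambda>q. g q u w) (at p) v
      - frechet_derivative (\<lambda>q. g q u v) (at p) w) / 2)"

definition nabla ::
  "'a::euclidean_space metric \<Rightarrow> ('a \<Rightarrow> 'a) \<Rightarrow> ('a \<Rightarrow> 'a) \<Rightarrow> 'a \<Rightarrow> 'a" where
  "nabla g X Y p = frechet_derivative Y (at p) (X p) + christoffel g p (X p) (Y p)"

definition lie_bracket ::
  "('a::euclidean_space \<Rightarrow> 'a) \<Rightarrow> ('a \<Rightarrow> 'a) \<Rightarrow> 'a \<Rightarrow> 'a" where
  "lie_bracket X Y p = frechet_derivative Y (at p) (X p) - frechet_derivative X (at p) (Y p)"

definition curvature ::
  "'a::euclidean_space metric \<Rightarrow> ('a \<Rightarrow> 'a) \<Rightarrow> ('a \<Rightarrow> 'a) \<Rightarrow> ('a \<Rightarrow> 'a) \<Rightarrow> 'a \<Rightarrow> 'a" where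
  "curvature g X Y Z p =
     nabla g X (nabla g Y Z) p - nabla g Y (nabla g X Z) p - nabla g (lie_bracket X Y) Z p"

text \<open>The curvature is tensorial, so its value on tangent vectors may be computed with any
  extension of them to vector fields; we take the constant one.\<close>

definition riemann :: "'a::euclidean_space metric \<Rightarrow> 'a \<Rightarrow> 'a \<Rightarrow> 'a \<Rightarrow> 'a \<Rightarrow> 'a" where
  "riemann g p u v w = curvature g (\<lambda>_. u) (\<lambda>_. v) (\<lambda>_. w) p"

section \<open>Tension and bitension field of a map\<close>

definition pushforward ::
  "('a::euclidean_space \<Rightarrow> 'b::euclidean_space) \<Rightarrow> 'a \<Rightarrow> 'a \<Rightarrow> 'b" where
  "pushforward \<phi> x u = frechet_derivative \<phi> (at x) u"

definition pullback_metric ::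
  "('a::euclidean_space \<Rightarrow> 'b::euclidean_space) \<Rightarrow> 'b metric \<Rightarrow> 'a metric" where
  "pullback_metric \<phi> h x u v = h (\<phi> x) (pushforward \<phi> x u) (pushforward \<phi> x v)"

text \<open>The pull-back connection \<open>\<nabla>\<^sup>\<phi>\<^sub>u V\<close> at \<open>x\<close>, for a section \<open>V\<close> of \<open>\<phi>\<^sup>-\<^sup>1TN\<close>,
  that is, \<open>V y\<close> is a tangent vector at \<open>\<phi> y\<close>.\<close>

definition nabla_along ::
  "'b::euclidean_space metric \<Rightarrow> ('a::euclidean_space \<Rightarrow> 'b) \<Rightarrow> ('a \<Rightarrow> 'b) \<Rightarrow> 'a \<Rightarrow> 'a \<Rightarrow> 'b"
  where
  "nabla_along h \<phi> V x u =
     frechet_derivative V (at x) u + christoffel h (\<phi> x) (pushforward \<phi> x u) (V x)"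

text \<open>\<open>\<nabla>d\<phi>\<close>, namely \<open>\<nabla>\<^sup>\<phi>\<^sub>u (d\<phi>(W)) - d\<phi>(\<nabla>\<^sup>M\<^sub>u W)\<close> for the constant extension
  \<open>W\<close> of \<open>w\<close>, so that \<open>\<nabla>\<^sup>M\<^sub>u W\<close> is a Christoffel term. For an isometric immersion
  this is the second fundamental form.\<close>

definition nabla_d ::
  "'a::euclidean_space metric \<Rightarrow> 'b::euclidean_space metric \<Rightarrow> ('a \<Rightarrow> 'b) \<Rightarrow> 'a \<Rightarrow> 'a \<Rightarrow> 'a \<Rightarrow> 'b"
  where
  "nabla_d g h \<phi> x u w =
     nabla_along h \<phi> (\<lambda>y. pushforward \<phi> y w) x u - pushforward \<phi> x (christoffel g x u w)"

definition tension ::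
  "'a::euclidean_space metric \<Rightarrow> 'b::euclidean_space metric \<Rightarrow> ('a \<Rightarrow> 'b) \<Rightarrow> 'a \<Rightarrow> 'b" where
  "tension g h \<phi> x = metric_trace g x (nabla_d g h \<phi> x)"

text \<open>\<open>(\<nabla>\<^sup>\<phi>\<nabla>\<^sup>\<phi> - \<nabla>\<^sup>\<phi>\<^bsub>\<nabla>\<^sup>M\<^esub>) V\<close> on \<open>u, w\<close>, with \<open>w\<close> extended as a
  constant field.\<close>

definition second_nabla_along ::
  "'a::euclidean_space metric \<Rightarrow> 'b::euclidean_space metric \<Rightarrow> ('a \<Rightarrow> 'b) \<Rightarrow> ('a \<Rightarrow> 'b) \<Rightarrow>
   'a \<Rightarrow> 'a \<Rightarrow> 'a \<Rightarrow> 'b" where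
  "second_nabla_along g h \<phi> V x u w =
     nabla_along h \<phi> (\<lambda>y. nabla_along h \<phi> V y w) x u
     - nabla_along h \<phi> V x (christoffel g x u w)"

definition bitension ::
  "'a::euclidean_space metric \<Rightarrow> 'b::euclidean_space metric \<Rightarrow> ('a \<Rightarrow> 'b) \<Rightarrow> 'a \<Rightarrow> 'b" where
  "bitension g h \<phi> x =
     metric_trace g x (second_nabla_along g h \<phi> (tension g h \<phi>) x)
     - metric_trace g x (\<lambda>u w.
         riemann h (\<phi> x) (pushforward \<phi> x u) (tension g h \<phi> x) (pushforward \<phi> x w))"

definition biharmonic_map ::
  "'a::euclidean_space set \<Rightarrow> 'a metric \<Rightarrow> 'b::euclidean_space set \<Rightarrow> 'b metric \<Rightarrow>
   ('a \<Rightarrow> 'b) \<Rightarrow> bool" where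
  "biharmonic_map M g N h \<phi> \<longleftrightarrow> \<phi> ` M \<subseteq> N \<and> (\<forall>x\<in>M. bitension g h \<phi> x = 0)"

section \<open>Biharmonic and minimal submanifolds\<close>

text \<open>A submanifold of \<open>(N, h)\<close> is given by a global parametrisation \<open>\<phi>\<close> (a smooth
  embedding of \<open>M\<close>), through which its inclusion map is read; \<open>M\<close> carries the
  induced metric.\<close>

definition biharmonic_submanifold ::
  "'a::euclidean_space set \<Rightarrow> 'b::euclidean_space set \<Rightarrow> 'b metric \<Rightarrow> ('a \<Rightarrow> 'b) \<Rightarrow> bool" where
  "biharmonic_submanifold M N h \<phi> \<longleftrightarrow> biharmonic_map M (pullback_metric \<phi> h) N h \<phi>"

definition mean_curvature_vector ::
  "'b::euclidean_space metric \<Rightarrow> ('a::euclidean_space \<Rightarrow> 'b) \<Rightarrow> 'a \<Rightarrow> 'b" where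
  "mean_curvature_vector h \<phi> x =
     (1 / real DIM('a)) *\<^sub>R
       metric_trace (pullback_metric \<phi> h) x (nabla_d (pullback_metric \<phi> h) h \<phi> x)"

definition minimal_submanifold ::
  "'a::euclidean_space set \<Rightarrow> 'b::euclidean_space metric \<Rightarrow> ('a \<Rightarrow> 'b) \<Rightarrow> bool" where
  "minimal_submanifold M h \<phi> \<longleftrightarrow> (\<forall>x\<in>M. mean_curvature_vector h \<phi> x = 0)"

definition proper_biharmonic_submanifold ::
  "'a::euclidean_space set \<Rightarrow> 'b::euclidean_space set \<Rightarrow> 'b metric \<Rightarrow> ('a \<Rightarrow> 'b) \<Rightarrow> bool" where
  "proper_biharmonic_submanifold M N h \<phi> \<longleftrightarrow>
     biharmonic_submanifold M N h \<phi> \<and> \<not> minimal_submanifold M h \<phi>"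

section \<open>The conformally flat half-space\<close>

text \<open>\<open>\<real>\<^sup>m\<^sup>+\<^sup>1\<close> is \<open>(real ^ 'm) \<times> real\<close>, with points \<open>(x, z)\<close>; its inner product is
  the flat metric \<open>\<Sum>\<^sub>i dx\<^sub>i\<^sup>2 + dz\<^sup>2\<close>.\<close>

definition half_space :: "real \<Rightarrow> ((real ^ 'm::finite) \<times> real) set" where
  "half_space C = {(x, z). z > - C}"

definition conformal_metric :: "(real \<Rightarrow> real) \<Rightarrow> ((real ^ 'm::finite) \<times> real) metric" where
  "conformal_metric f p u v = f (snd p) powi (-2) * (u \<bullet> v)"

definition hyperplane :: "real \<Rightarrow> (real ^ 'm::finite) \<Rightarrow> (real ^ 'm) \<times> real" where
  "hyperplane k x = (x, k)"

definition smooth_real_on :: "real set \<Rightarrow> (real \<Rightarrow> real) \<Rightarrow> bool" where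
  "smooth_real_on S f \<longleftrightarrow> (\<forall>n. \<forall>z\<in>S. ((deriv ^^ n) f) differentiable (at z))"

end

theory Submission
  imports Defs
begin

text \<open>
  Put \<open>s = - f' / f\<close>, the derivative of \<open>\<sigma>\<close> in \<open>h = e\<^bsup>2\<sigma>\<^esup>(dx\<^sup>2 + dz\<^sup>2)\<close>. The plane
  \<open>z = k\<close> has a constant induced metric, its tension field is \<open>- m f\<^sup>2 s \<partial>\<^sub>z\<close>, and its
  bitension field is \<open>m\<^sup>2 f\<^sup>4 s (s' + s\<^sup>2) \<partial>\<^sub>z\<close>. So all planes are proper biharmonic iff
  \<open>s\<close> vanishes nowhere and \<open>s' + s\<^sup>2 = 0\<close>. Since \<open>(1/f)' = s/f\<close> and
  \<open>(1/f)'' = (s' + s\<^sup>2)/f\<close>, this says that \<open>1/f\<close> is a nonconstant affine function; it has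
  no zero in \<open>(-C, \<infinity>)\<close>, whence \<open>E \<ge> C\<close>.
\<close>

section \<open>Metrics that are scalar multiples of the inner product\<close>

lemma sharp_scaled_inner:
  fixes g :: "'a::euclidean_space metric"
  assumes "\<And>u v. g p u v = c * (u \<bullet> v)" "c \<noteq> 0" "\<And>v. \<alpha> v = c * (w \<bullet> v)"
  shows "sharp g p \<alpha> = w"
  unfolding sharp_def
proof (rule the_equality)
  show "\<forall>v. g p w v = \<alpha> v"
    using assms by simp
next
  fix w' assume "\<forall>v. g p w' v = \<alpha> v"
  then have "w' \<bullet> v = w \<bullet> v" for v
    using assms by simp
  then show "w' = w"
    by (metis vector_eq_rdot)
qed

lemma metric_trace_scaled_inner:
  fixes g :: "'a::euclidean_space metric"
  assumes "\<And>u v. g p u v = c * (u \<bullet> v)" "c \<noteq> 0"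
  shows "metric_trace g p B = (\<Sum>e\<in>Basis. B e (inverse c *\<^sub>R e))"
proof -
  have "sharp g p (\<lambda>v. e \<bullet> v) = inverse c *\<^sub>R e" for e
    by (rule sharp_scaled_inner[of g p c]) (use assms in auto)
  then show ?thesis
    by (simp add: metric_trace_def)
qed

text \<open>Every form traced over a plane below is of this umbilic shape, so each trace reduces to
  one scalar factor.\<close>

lemma metric_trace_scaled_inner_umbilic:
  fixes g :: "'a::euclidean_space metric"
  assumes "\<And>u v. g p u v = c * (u \<bullet> v)" "c \<noteq> 0" "\<And>u v. B u v = (u \<bullet> v) *\<^sub>R w"
  shows "metric_trace g p B = (real DIM('a) / c) *\<^sub>R w"
proof -
  have "metric_trace g p B = (\<Sum>e\<in>(Basis :: 'a set). inverse c *\<^sub>R w)"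
    unfolding metric_trace_scaled_inner[of g p c, OF assms(1,2)]
    by (rule sum.cong) (simp_all add: assms(3))
  then show ?thesis
    by (simp add: scaleR_conv_of_real sum_constant_scaleR divide_inverse)
qed

lemma christoffel_constant_metric:
  fixes g :: "'a::euclidean_space metric"
  assumes "\<And>p u v. g p u v = c * (u \<bullet> v)" "c \<noteq> 0"
  shows "christoffel g p u v = 0"
  unfolding christoffel_def
  by (rule sharp_scaled_inner[of g p c]) (use assms in auto)

lemma pushforward_hyperplane: "pushforward (hyperplane k) x u = (u, 0)"
proof -
  have "(hyperplane k has_derivative (\<lambda>u. (u, 0))) (at x)"
    unfolding hyperplane_def by (auto intro!: derivative_eq_intros)
  then show ?thesis
    by (simp add: pushforward_def flip: frechet_derivative_at)
qed

lemma pullback_metric_hyperplane: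
  "pullback_metric (hyperplane k) (conformal_metric f) x u v = f k powi (-2) * (u \<bullet> v)"
  by (simp add: pullback_metric_def pushforward_hyperplane conformal_metric_def hyperplane_def)

section \<open>Connection and curvature of the conformal metric\<close>

locale conformal_half_space =
  fixes C :: real and f f' f'' :: "real \<Rightarrow> real"
  assumes deriv_f: "\<And>z. z > - C \<Longrightarrow> (f has_real_derivative f' z) (at z)"
    and deriv_f': "\<And>z. z > - C \<Longrightarrow> (f' has_real_derivative f'' z) (at z)"
    and f_nz: "\<And>z. z > - C \<Longrightarrow> f z \<noteq> 0"
begin

definition s :: "real \<Rightarrow> real" where
  "s z = - f' z / f z"

definition s' :: "real \<Rightarrow> real" where
  "s' z = - f'' z / f z + (f' z)\<^sup>2 / (f z)\<^sup>2"

lemma deriv_s: "z > - C \<Longrightarrow> (s has_real_derivative s' z) (at z)"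
  unfolding s_def[abs_def] s'_def
  using f_nz[of z]
  by (auto intro!: derivative_eq_intros deriv_f deriv_f' simp: field_simps power2_eq_square)

lemma s_snd_has_derivative:
  fixes p :: "(real ^ 'm) \<times> real"
  assumes "snd p > - C"
  shows "((\<lambda>q. s (snd q)) has_derivative (\<lambda>u. s' (snd p) * snd u)) (at p)"
proof -
  have "(s has_derivative (*) (s' (snd p))) (at (snd p))"
    using deriv_s[OF assms] by (simp add: has_field_derivative_def)
  from has_derivative_compose[OF has_derivative_snd[OF has_derivative_ident] this]
  show ?thesis .
qed

text \<open>The factor \<open>f powi (-2)\<close> has logarithmic derivative - 2 f' / f = 2
  s.\<close>

lemma conformal_metric_derivative:
  fixes p :: "(real ^ 'm) \<times> real"
  assumes "snd p > - C"
  shows "frechet_derivative (\<lambda>q. conformal_metric f q v w) (at p) u =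
    2 * s (snd p) * snd u * conformal_metric f p v w"
proof -
  have "((\<lambda>z. f z powi (-2)) has_real_derivative 2 * s (snd p) * f (snd p) powi (-2)) (at (snd p))"
    using f_nz[OF assms] unfolding s_def
    by (auto intro!: derivative_eq_intros deriv_f assms
        simp: power_int_minus field_simps power2_eq_square power3_eq_cube)
  then have "((\<lambda>z. f z powi (-2)) has_derivative (*) (2 * s (snd p) * f (snd p) powi (-2)))
      (at (snd p))"
    by (simp add: has_field_derivative_def)
  from has_derivative_compose[OF has_derivative_snd[OF has_derivative_ident] this]
  have "((\<lambda>q. conformal_metric f q v w) has_derivative
      (\<lambda>u. 2 * s (snd p) * f (snd p) powi (-2) * snd u * (v \<bullet> w))) (at p)"
    unfolding conformal_metric_def by (rule has_derivative_mult_left)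
  then show ?thesis
    by (simp add: conformal_metric_def flip: frechet_derivative_at)
qed

text \<open>This is the usual conformal change formula with conformal exponent of differential s dz.
  In Koszul's formula the last term carries \<open>snd w\<close>, the inner product of
  \<open>w\<close> with \<open>(0, 1)\<close>, which yields the gradient term.\<close>

lemma christoffel_conformal_metric:
  fixes p :: "(real ^ 'm) \<times> real"
  assumes "snd p > - C"
  shows "christoffel (conformal_metric f) p u v =
    s (snd p) *\<^sub>R (snd u *\<^sub>R v + snd v *\<^sub>R u - (u \<bullet> v) *\<^sub>R (0, 1))"
  unfolding christoffel_def
proof (rule sharp_scaled_inner[of "conformal_metric f" p "f (snd p) powi (-2)"])
  show "f (snd p) powi (-2) \<noteq> 0"
    using f_nz[OF assms] by simp
  show "(frechet_derivative (\<lambda>q. conformal_metric f q v w) (at p) u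
      + frechet_derivative (\<lambda>q. conformal_metric f q u w) (at p) v
      - frechet_derivative (\<lambda>q. conformal_metric f q u v) (at p) w) / 2
    = f (snd p) powi (-2) *
      (s (snd p) *\<^sub>R (snd u *\<^sub>R v + snd v *\<^sub>R u - (u \<bullet> v) *\<^sub>R (0, 1)) \<bullet> w)" for w
    unfolding conformal_metric_derivative[OF assms]
    unfolding conformal_metric_def
    by (cases w) (simp add: field_simps inner_diff_left inner_add_left)
qed (simp add: conformal_metric_def)

lemma nabla_conformal_constant:
  fixes p :: "(real ^ 'm) \<times> real"
  assumes "snd p > - C"
  shows "nabla (conformal_metric f) (\<lambda>_. u) (\<lambda>_. v) p =
    s (snd p) *\<^sub>R (snd u *\<^sub>R v + snd v *\<^sub>R u - (u \<bullet> v) *\<^sub>R (0, 1))"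
  by (simp add: nabla_def christoffel_conformal_metric[OF assms])

text \<open>The inner derivative is the scalar \<open>s\<close> times the constant vector
  \<open>A v w\<close>. Differentiating the scalar gives the \<open>s'\<close> term; the Christoffel
  term brings a second factor \<open>s\<close>.\<close>

lemma nabla_nabla_conformal_constant:
  fixes p :: "(real ^ 'm) \<times> real"
  assumes p: "snd p > - C"
  defines "A \<equiv> \<lambda>u v. snd u *\<^sub>R v + snd v *\<^sub>R u - (u \<bullet> v) *\<^sub>R (0, 1) :: (real ^ 'm) \<times> real"
  shows "nabla (conformal_metric f) (\<lambda>_. u) (nabla (conformal_metric f) (\<lambda>_. v) (\<lambda>_. w)) p =
    (s' (snd p) * snd u) *\<^sub>R A v w + (s (snd p))\<^sup>2 *\<^sub>R A u (A v w)"
proof -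
  define S :: "((real ^ 'm) \<times> real) set" where "S = snd -` {- C<..}"
  have "open S"
    unfolding S_def by (intro open_vimage_snd open_greaterThan)
  have "((\<lambda>q. s (snd q) *\<^sub>R A v w) has_derivative
      (\<lambda>u. (s' (snd p) * snd u) *\<^sub>R A v w)) (at p)"
    by (rule has_derivative_scaleR_left[OF s_snd_has_derivative[OF p]])
  \<comment> \<open>The closed formula for the inner derivative is available on the open set
    \<open>S\<close> around \<open>p\<close>, which suffices to differentiate it at
    \<open>p\<close>.\<close>
  then have "(nabla (conformal_metric f) (\<lambda>_. v) (\<lambda>_. w) has_derivative
      (\<lambda>u. (s' (snd p) * snd u) *\<^sub>R A v w)) (at p)"
    by (rule has_derivative_transform_within_open[OF _ \<open>open S\<close>])
      (use p in \<open>auto simp: S_def A_def nabla_conformal_constant\<close>)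
  then have "frechet_derivative (nabla (conformal_metric f) (\<lambda>_. v) (\<lambda>_. w)) (at p) u
      = (s' (snd p) * snd u) *\<^sub>R A v w"
    by (simp flip: frechet_derivative_at)
  moreover have "A u (c *\<^sub>R v) = c *\<^sub>R A u v" for c v
    by (simp add: A_def scaleR_diff_right scaleR_add_right scaleR_left_commute mult.commute)
  moreover have "christoffel (conformal_metric f) p u v = s (snd p) *\<^sub>R A u v"
    and "nabla (conformal_metric f) (\<lambda>_. u) (\<lambda>_. v) p = s (snd p) *\<^sub>R A u v" for u v
    by (simp_all add: A_def christoffel_conformal_metric[OF p] nabla_conformal_constant[OF p])
  ultimately show ?thesis
    by (simp add: nabla_def[of _ _ "nabla _ _ _"] power2_eq_square)
qed

text \<open>The two iterated derivatives have the same quadratic part, - s^2 t (u, w) times the unit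
  normal \<open>(0, 1)\<close>, so it cancels. What remains comes from differentiating
  \<open>s\<close> in the normal direction.\<close>

lemma riemann_conformal_normal:
  fixes p :: "(real ^ 'm) \<times> real"
  assumes p: "snd p > - C"
  shows "riemann (conformal_metric f) p (u, 0) (0, t) (w, 0) = (u \<bullet> w) *\<^sub>R (0, s' (snd p) * t)"
proof -
  \<comment> \<open>Constant fields commute, so the bracket term drops out.\<close>
  have "nabla (conformal_metric f) (lie_bracket (\<lambda>_. (u, 0)) (\<lambda>_. (0, t))) (\<lambda>_. (w, 0)) p = 0"
    using nabla_conformal_constant[OF p, of 0 "(w, 0)"]
    by (simp add: lie_bracket_def[abs_def] zero_prod_def)
  then show ?thesis
    unfolding riemann_def curvature_def nabla_nabla_conformal_constant[OF p]
    by (simp add: power2_eq_square algebra_simps)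
qed

section \<open>Extrinsic geometry of a single hyperplane\<close>

context
  fixes k :: real
  assumes k: "k > - C"
begin

text \<open>Along the plane the conformal factor is frozen at \<open>f k\<close>, so the induced
  metric is flat.\<close>

lemma christoffel_induced_metric:
  fixes x :: "real ^ 'm"
  shows "christoffel (pullback_metric (hyperplane k) (conformal_metric f)) x u v = 0"
  by (rule christoffel_constant_metric[where c = "f k powi (-2)"])
    (simp_all add: pullback_metric_hyperplane f_nz k)

lemma metric_trace_induced_umbilic:
  fixes x :: "real ^ 'm"
  assumes "\<And>u v. B u v = (u \<bullet> v) *\<^sub>R w"
  shows "metric_trace (pullback_metric (hyperplane k) (conformal_metric f)) x B =
    (real CARD('m) * (f k)\<^sup>2) *\<^sub>R w"
  using metric_trace_scaled_inner_umbilic[of "pullback_metric (hyperplane k) (conformal_metric f)" x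
      "f k powi (-2)" B w] assms f_nz[OF k]
  by (simp add: pullback_metric_hyperplane power_int_minus divide_inverse)

text \<open>Tangent vectors have no z-component, so of the ambient Christoffel form just the
  gradient term survives: the plane is totally umbilic.\<close>

lemma nabla_d_hyperplane:
  fixes x :: "real ^ 'm"
  shows "nabla_d (pullback_metric (hyperplane k) (conformal_metric f)) (conformal_metric f)
    (hyperplane k) x u w = (u \<bullet> w) *\<^sub>R (0, - s k)"
  unfolding nabla_d_def nabla_along_def pushforward_hyperplane christoffel_induced_metric
  by (simp add: christoffel_conformal_metric k hyperplane_def)

lemma tension_hyperplane:
  fixes x :: "real ^ 'm"
  shows "tension (pullback_metric (hyperplane k) (conformal_metric f)) (conformal_metric f)
    (hyperplane k) x = (0, - real CARD('m) * (f k)\<^sup>2 * s k)"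
  unfolding tension_def metric_trace_induced_umbilic[OF nabla_d_hyperplane]
  by simp

text \<open>Differentiating the constant normal field along \<open>w\<close> gives the tangent
  vector \<open>(w, 0)\<close> scaled by s t; differentiating that along \<open>u\<close> returns to
  the normal direction with factor - s^2 t.\<close>

lemma second_nabla_along_hyperplane:
  fixes x :: "real ^ 'm"
  shows "second_nabla_along (pullback_metric (hyperplane k) (conformal_metric f))
    (conformal_metric f) (hyperplane k) (\<lambda>_. (0, t)) x u w = (u \<bullet> w) *\<^sub>R (0, - (s k)\<^sup>2 * t)"
  unfolding second_nabla_along_def nabla_along_def pushforward_hyperplane christoffel_induced_metric
  by (simp add: christoffel_conformal_metric k hyperplane_def power2_eq_square)

lemma bitension_hyperplane:
  fixes x :: "real ^ 'm"
  shows "bitension (pullback_metric (hyperplane k) (conformal_metric f)) (conformal_metric f)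
    (hyperplane k) x = (0, (real CARD('m))\<^sup>2 * (f k) ^ 4 * s k * (s' k + (s k)\<^sup>2))"
proof -
  let ?g = "pullback_metric (hyperplane k) (conformal_metric f) :: (real ^ 'm) metric"
  define t where "t = - real CARD('m) * (f k)\<^sup>2 * s k"
  \<comment> \<open>The tension field is constant along the plane, so the formula for constant
    normal fields applies to it.\<close>
  have tension: "tension ?g (conformal_metric f) (hyperplane k) = (\<lambda>_. (0, t))"
    by (rule ext) (simp add: tension_hyperplane t_def)
  have "riemann (conformal_metric f) (hyperplane k x) (u, 0) (0, t) (w, 0)
      = (u \<bullet> w) *\<^sub>R (0, s' k * t)" for u w :: "real ^ 'm"
    using riemann_conformal_normal[of "hyperplane k x"] k by (simp add: hyperplane_def)
  note traces = metric_trace_induced_umbilic[OF second_nabla_along_hyperplane]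
    metric_trace_induced_umbilic[OF this]
  show ?thesis
    unfolding bitension_def tension pushforward_hyperplane traces
    by (simp add: t_def algebra_simps power2_eq_square power4_eq_xxxx)
qed

lemma minimal_hyperplane_iff:
  "minimal_submanifold UNIV (conformal_metric f) (hyperplane k :: real ^ 'm \<Rightarrow> _) \<longleftrightarrow> s k = 0"
proof -
  have "mean_curvature_vector (conformal_metric f) (hyperplane k) x
      = (0, - (f k)\<^sup>2 * s k)" for x :: "real ^ 'm"
    unfolding mean_curvature_vector_def tension_def[symmetric] tension_hyperplane by simp
  then show ?thesis
    using f_nz[OF k] by (simp add: minimal_submanifold_def zero_prod_def)
qed

text \<open>Non-minimality is \<open>s k \<noteq> 0\<close>, which allows the factor
  \<open>s k\<close> of the bitension field to be cancelled; \<open>f k\<close> and the dimension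
  are nonzero as well.\<close>

lemma proper_biharmonic_hyperplane_iff:
  "proper_biharmonic_submanifold UNIV (half_space C) (conformal_metric f)
    (hyperplane k :: real ^ 'm \<Rightarrow> _) \<longleftrightarrow> s k \<noteq> 0 \<and> s' k + (s k)\<^sup>2 = 0"
proof -
  have "range (hyperplane k :: real ^ 'm \<Rightarrow> _) \<subseteq> half_space C"
    using k by (auto simp: hyperplane_def half_space_def)
  then show ?thesis
    using f_nz[OF k]
    by (auto simp: proper_biharmonic_submanifold_def biharmonic_submanifold_def
        biharmonic_map_def bitension_hyperplane minimal_hyperplane_iff zero_prod_def)
qed

end

section \<open>The differential equation for 1/f\<close>

lemma deriv_inverse_f: "z > - C \<Longrightarrow> ((\<lambda>z. 1 / f z) has_real_derivative s z / f z) (at z)"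
  using f_nz[of z] unfolding s_def
  by (auto intro!: derivative_eq_intros deriv_f simp: field_simps)

lemma deriv_inverse_f':
  assumes "z > - C"
  shows "((\<lambda>z. s z / f z) has_real_derivative (s' z + (s z)\<^sup>2) / f z) (at z)"
proof -
  have "f' z = - s z * f z"
    using f_nz[OF assms] by (simp add: s_def)
  then have "(s' z * f z - s z * f' z) / (f z * f z) = (s' z + (s z)\<^sup>2) / f z"
    using f_nz[OF assms] by (simp add: field_simps power2_eq_square)
  then show ?thesis
    using DERIV_divide[OF deriv_s[OF assms] deriv_f[OF assms] f_nz[OF assms]] by simp
qed

lemma ode_iff:
  "(\<forall>z > - C. s z \<noteq> 0 \<and> s' z + (s z)\<^sup>2 = 0) \<longleftrightarrow>
    (\<exists>E D. E \<ge> C \<and> D \<noteq> 0 \<and> (\<forall>z > - C. f z = D / (z + E)))"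
proof
  assume ode: "\<forall>z > - C. s z \<noteq> 0 \<and> s' z + (s z)\<^sup>2 = 0"
  have "\<exists>a. \<forall>z\<in>{- C<..}. s z / f z = a"
  proof (rule has_field_derivative_zero_constant)
    show "((\<lambda>z. s z / f z) has_field_derivative 0) (at z within {- C<..})" if "z \<in> {- C<..}" for z
      using deriv_inverse_f'[of z] ode that by (auto intro: has_field_derivative_at_within)
  qed simp
  then obtain a where a: "\<And>z. z > - C \<Longrightarrow> s z / f z = a"
    by auto
  have "\<exists>b. \<forall>z\<in>{- C<..}. 1 / f z - a * z = b"
  proof (rule has_field_derivative_zero_constant)
    show "((\<lambda>z. 1 / f z - a * z) has_field_derivative 0) (at z within {- C<..})"
      if "z \<in> {- C<..}" for z
      using DERIV_diff[OF deriv_inverse_f[of z] DERIV_cmult_Id[of a]] a[of z] that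
      by (auto intro: has_field_derivative_at_within)
  qed simp
  then obtain b where b: "\<And>z. z > - C \<Longrightarrow> 1 / f z - a * z = b"
    by auto
  \<comment> \<open>Any point of the ray would do; \<open>1 - C\<close> is one.\<close>
  have "a \<noteq> 0"
    using a[of "1 - C"] ode f_nz[of "1 - C"] by force
  \<comment> \<open>Factoring out the slope exhibits the witnesses E = b/a and D = 1/a.\<close>
  have inv: "1 / f z = a * (z + b / a)" if "z > - C" for z
    using b[OF that] \<open>a \<noteq> 0\<close> by (simp add: field_simps)
  have "f z = (1 / a) / (z + b / a)" if "z > - C" for z
    using inv[OF that] by (metis divide_divide_eq_left div_by_1 divide_divide_eq_right mult_1)
  \<comment> \<open>Otherwise - b/a lies in the ray, and 1/f would vanish there.\<close>
  moreover have "C \<le> b / a"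
  proof (rule ccontr)
    assume "\<not> C \<le> b / a"
    then show False
      using inv[of "- (b / a)"] f_nz[of "- (b / a)"] by simp
  qed
  ultimately show "\<exists>E D. E \<ge> C \<and> D \<noteq> 0 \<and> (\<forall>z > - C. f z = D / (z + E))"
    using \<open>a \<noteq> 0\<close> by (intro exI[of _ "b / a"] exI[of _ "1 / a"]) auto
next
  assume "\<exists>E D. E \<ge> C \<and> D \<noteq> 0 \<and> (\<forall>z > - C. f z = D / (z + E))"
  then obtain E D where E: "E \<ge> C" and "D \<noteq> 0" and f: "\<And>z. z > - C \<Longrightarrow> f z = D / (z + E)"
    by auto
  \<comment> \<open>Both sides are the derivative of 1/f, which is (z + E)/D on the ray.\<close>
  have inv: "s z / f z = 1 / D" if "z > - C" for z
  proof (rule DERIV_unique[OF deriv_inverse_f[OF that]])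
    have "((\<lambda>z. (z + E) / D) has_real_derivative 1 / D) (at z)"
      using \<open>D \<noteq> 0\<close> by (auto intro!: derivative_eq_intros)
    then show "((\<lambda>z. 1 / f z) has_real_derivative 1 / D) (at z)"
      by (rule has_field_derivative_transform_within_open[of _ _ _ "{- C<..}"])
        (use that in \<open>auto simp: f\<close>)
  qed
  have "s' z + (s z)\<^sup>2 = 0" if "z > - C" for z
  proof -
    \<comment> \<open>Constancy of s/f makes its derivative zero; comparison with the general
      formula for that derivative gives the equation.\<close>
    have "((\<lambda>z. s z / f z) has_real_derivative 0) (at z)"
      by (rule has_field_derivative_transform_within_open[of "\<lambda>_. 1 / D" _ _ "{- C<..}"])
        (use that in \<open>auto simp: inv\<close>)
    with deriv_inverse_f'[OF that] have "(s' z + (s z)\<^sup>2) / f z = 0"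
      by (rule DERIV_unique)
    then show ?thesis
      using f_nz[OF that] by simp
  qed
  moreover have "s z \<noteq> 0" if "z > - C" for z
    using inv[OF that] \<open>D \<noteq> 0\<close> by auto
  ultimately show "\<forall>z > - C. s z \<noteq> 0 \<and> s' z + (s z)\<^sup>2 = 0"
    by blast
qed

end

theorem theorem3p1:
  fixes C :: real and f :: "real \<Rightarrow> real"
  assumes "smooth_real_on {- C<..} f"
    and "\<forall>z > - C. f z \<noteq> 0"
  shows "(\<forall>k > - C. proper_biharmonic_submanifold UNIV
             (half_space C :: ((real ^ 'm::finite) \<times> real) set) (conformal_metric f) (hyperplane k))
         \<longleftrightarrow> (\<exists>E D. E \<ge> C \<and> D \<noteq> 0 \<and> (\<forall>z > - C. f z = D / (z + E)))"
proof -
  have diff: "(deriv ^^ n) f field_differentiable at z" if "z > - C" for n z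
    using assms(1) that by (auto simp: smooth_real_on_def field_differentiable_def real_differentiable_def)
  interpret conformal_half_space C f "deriv f" "deriv (deriv f)"
  proof
    fix z assume z: "z > - C"
    show "(f has_real_derivative deriv f z) (at z)"
      using diff[OF z, of 0] by (simp add: field_differentiable_derivI)
    show "(deriv f has_real_derivative deriv (deriv f) z) (at z)"
      using diff[OF z, of 1] by (simp add: field_differentiable_derivI)
    show "f z \<noteq> 0"
      using assms(2) z by blast
  qed
  show ?thesis
    \<comment> \<open>The geometric condition translates plane by plane, with \<open>k\<close> in
      the role of \<open>z\<close>.\<close>
    using ode_iff by (simp add: proper_biharmonic_hyperplane_iff)
qed

end
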